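(* Let $K$ be an infinite field, $H\subseteq K[x_0,\dots,x_{n-1}]$ a homogeneous ideal, $\prec$ a term order on the terms in $x_0,\dots,x_{n-1}$, and let $\mathfrak h_0\subset K[C]$ be the ideal constructed from $H$ and $\prec$ as described in the context. Then $\mathfrak h_0$ is homogeneous with respect to the grading of $K[C]$ induced by the weight vector $\omega(C_{\alpha\gamma})=\gamma_n+1$, where $C_{\alpha\gamma}$ is the coefficient of the term $x_nx^\gamma$ in $g_\alpha$ and $\gamma_n$ is the exponent of $x_n$ in $x^\gamma$.
   Context: Notation: $\mathbf x=\{x_0,\dots,x_{n-1}\}$. A term is a monic monomial $x^\alpha$, $|\alpha|$ its degree. Given a term order $\prec$ on terms in $\mathbf x$, $\prec_n$ is the graded term order on terms in $\mathbf x,x_n$ such that for terms of the same degree $x^\alpha\prec_n x^\beta$ iff $\alpha_n>\beta_n$, or $\alpha_n=\beta_n$ and $x^\alpha/x_n^{\alpha_n}\prec x^\beta/x_n^{\beta_n}$. Construction of $\mathfrak h_0$: let $\{f_\alpha\}_\alpha$ be the reduced Gröbner basis of $H$ w.r.t. $\prec$, where $f_\alpha$ has head term $x^\alpha$ and $x^\alpha$ runs over the minimal monomial generators of $\mathrm{in}_\prec(H)$. Let $J=\mathrm{in}_\prec(H)K[\mathbf x,x_n]$ and let $\mathcal N(J)_d$ be the set of terms of degree $d$ in $\mathbf x,x_n$ not in $J$. Put $g_\alpha=\sum_{x_nx^\gamma\in\mathcal N(J)_{|\alpha|}}C_{\alpha\gamma}\,x_nx^\gamma$, where the $C_{\alpha\gamma}$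 are new variables and $x^\gamma$ is a term in $\mathbf x,x_n$; let $C$ be the set of all $C_{\alpha\gamma}$ and $\mathcal G=\{f_\alpha+g_\alpha\}_\alpha\subset K[C][\mathbf x,x_n]$. Extend $\prec_n$ to an elimination order of $\mathbf x,x_n$ on $K[C][\mathbf x,x_n]$ (terms are compared first by their $\mathbf x,x_n$-part via $\prec_n$, then by a fixed term order on $K[C]$). Then $\mathfrak h_0\subseteq K[C]$ is the ideal generated by the coefficients (in $K[C]$) of the terms in $\mathbf x,x_n$ in a complete reduction by $\mathcal G$ with respect to $\prec_n$ of the $S$-polynomial $S(f_\alpha+g_\alpha,f_{\alpha'}+g_{\alpha'})$, for all pairs $\alpha,\alpha'$ (this ideal does not depend on the chosen complete reductions). *)

theory Defs
  imports "HOL-Library.Poly_Mapping" "HOL-Algebra.Ideal"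
begin

section \<open>Polynomials in a set of variables\<close>

text \<open>
  A term is a finitely supported exponent vector. The ring $K[V]$, for a set $V$ of variables
  taken from a type of variable names, consists of the polynomials whose terms only involve
  variables of $V$.
\<close>

type_synonym 'v trm = "'v \<Rightarrow>\<^sub>0 nat"
type_synonym ('v, 'k) mpoly = "('v \<Rightarrow>\<^sub>0 nat) \<Rightarrow>\<^sub>0 'k"

definition terms :: "'v set \<Rightarrow> 'v trm set" where
  "terms V = {t. Poly_Mapping.keys t \<subseteq> V}"

definition poly_ring :: "'v set \<Rightarrow> ('v, 'k::field) mpoly ring" where
  "poly_ring V =
     \<lparr>carrier = {p. Poly_Mapping.keys p \<subseteq> terms V}, mult = (*), one = 1, zero = 0, add = (+)\<rparr>"

definition term_dvd :: "'v trm \<Rightarrow> 'v trm \<Rightarrow> bool" where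
  "term_dvd s t \<longleftrightarrow> (\<forall>v. Poly_Mapping.lookup s v \<le> Poly_Mapping.lookup t v)"

text \<open>Subtraction of exponents is truncated, so the exponents below are the pointwise maxima.\<close>

definition term_lcm :: "'v trm \<Rightarrow> 'v trm \<Rightarrow> 'v trm" where
  "term_lcm s t = s + (t - s)"

text \<open>
  The push-forward of a finitely supported function. For injective \<open>f\<close> it renames the variables
  of a term, and \<open>push (push f)\<close> renames the variables of a polynomial.
\<close>

definition push :: "('a \<Rightarrow> 'b) \<Rightarrow> ('a \<Rightarrow>\<^sub>0 'c::comm_monoid_add) \<Rightarrow> ('b \<Rightarrow>\<^sub>0 'c)" where
  "push f p = (\<Sum>a\<in>Poly_Mapping.keys p. Poly_Mapping.single (f a) (Poly_Mapping.lookup p a))"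


section \<open>Gradings\<close>

definition weight :: "('v \<Rightarrow> nat) \<Rightarrow> 'v trm \<Rightarrow> nat" where
  "weight w t = (\<Sum>v\<in>Poly_Mapping.keys t. w v * Poly_Mapping.lookup t v)"

abbreviation tdeg :: "'v trm \<Rightarrow> nat" where
  "tdeg \<equiv> weight (\<lambda>_. 1)"

definition component :: "('v \<Rightarrow> nat) \<Rightarrow> nat \<Rightarrow> ('v, 'k::field) mpoly \<Rightarrow> ('v, 'k) mpoly" where
  "component w d p =
     (\<Sum>t\<in>{t\<in>Poly_Mapping.keys p. weight w t = d}.
        Poly_Mapping.single t (Poly_Mapping.lookup p t))"

definition homogeneous_ideal ::
    "'v set \<Rightarrow> ('v \<Rightarrow> nat) \<Rightarrow> ('v, 'k::field) mpoly set \<Rightarrow> bool" where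
  "homogeneous_ideal V w I \<longleftrightarrow>
     ideal I (poly_ring V) \<and> (\<forall>p\<in>I. \<forall>d. component w d p \<in> I)"


section \<open>Term orders, Groebner bases and reduction\<close>

text \<open>A term order is given by its strict part, and only matters on the terms in \<open>V\<close>.\<close>

definition term_order :: "'v set \<Rightarrow> ('v trm \<Rightarrow> 'v trm \<Rightarrow> bool) \<Rightarrow> bool" where
  "term_order V lt \<longleftrightarrow>
     irreflp_on (terms V) lt \<and> transp_on (terms V) lt \<and> totalp_on (terms V) lt \<and>
     (\<forall>t\<in>terms V. t \<noteq> 0 \<longrightarrow> lt 0 t) \<and>
     (\<forall>s\<in>terms V. \<forall>t\<in>terms V. \<forall>u\<in>terms V. lt s t \<longrightarrow> lt (s + u) (t + u))"

definition head_term :: "('v trm \<Rightarrow> 'v trm \<Rightarrow> bool) \<Rightarrow> ('v, 'k::field) mpoly \<Rightarrow> 'v trm" where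
  "head_term lt p =
     (THE t. t \<in> Poly_Mapping.keys p \<and> (\<forall>s\<in>Poly_Mapping.keys p. s \<noteq> t \<longrightarrow> lt s t))"

definition head_coeff :: "('v trm \<Rightarrow> 'v trm \<Rightarrow> bool) \<Rightarrow> ('v, 'k::field) mpoly \<Rightarrow> 'k" where
  "head_coeff lt p = Poly_Mapping.lookup p (head_term lt p)"

definition head_ideal ::
    "'v set \<Rightarrow> ('v trm \<Rightarrow> 'v trm \<Rightarrow> bool) \<Rightarrow> ('v, 'k::field) mpoly set \<Rightarrow> ('v, 'k) mpoly set" where
  "head_ideal V lt S =
     Idl\<^bsub>poly_ring V\<^esub> {Poly_Mapping.single (head_term lt p) 1 | p. p \<in> S \<and> p \<noteq> 0}"

definition groebner_basis ::
    "'v set \<Rightarrow> ('v trm \<Rightarrow> 'v trm \<Rightarrow> bool) \<Rightarrow> ('v, 'k::field) mpoly set \<Rightarrow> ('v, 'k) mpoly set \<Rightarrow> bool"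
    where
  "groebner_basis V lt I G \<longleftrightarrow>
     finite G \<and> G \<subseteq> I \<and> 0 \<notin> G \<and> head_ideal V lt G = head_ideal V lt I"

definition reduced_groebner_basis ::
    "'v set \<Rightarrow> ('v trm \<Rightarrow> 'v trm \<Rightarrow> bool) \<Rightarrow> ('v, 'k::field) mpoly set \<Rightarrow> ('v, 'k) mpoly set \<Rightarrow> bool"
    where
  "reduced_groebner_basis V lt I G \<longleftrightarrow>
     groebner_basis V lt I G \<and>
     (\<forall>g\<in>G. head_coeff lt g = 1) \<and>
     (\<forall>g\<in>G. \<forall>h\<in>G - {g}. \<forall>t\<in>Poly_Mapping.keys g. \<not> term_dvd (head_term lt h) t)"

definition S_poly ::
    "('v trm \<Rightarrow> 'v trm \<Rightarrow> bool) \<Rightarrow> ('v, 'k::field) mpoly \<Rightarrow> ('v, 'k) mpoly \<Rightarrow> ('v, 'k) mpoly" where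
  "S_poly lt p q =
     (let m = term_lcm (head_term lt p) (head_term lt q)
      in Poly_Mapping.single (m - head_term lt p) (1 / head_coeff lt p) * p
       - Poly_Mapping.single (m - head_term lt q) (1 / head_coeff lt q) * q)"

definition reduces ::
    "('v trm \<Rightarrow> 'v trm \<Rightarrow> bool) \<Rightarrow> ('v, 'k::field) mpoly set \<Rightarrow> ('v, 'k) mpoly \<Rightarrow> ('v, 'k) mpoly \<Rightarrow> bool"
    where
  "reduces lt G p q \<longleftrightarrow>
     (\<exists>g\<in>G. \<exists>t\<in>Poly_Mapping.keys p. g \<noteq> 0 \<and> term_dvd (head_term lt g) t \<and>
        q = p - Poly_Mapping.single (t - head_term lt g)
                  (Poly_Mapping.lookup p t / head_coeff lt g) * g)"

definition complete_reduction ::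
    "('v trm \<Rightarrow> 'v trm \<Rightarrow> bool) \<Rightarrow> ('v, 'k::field) mpoly set \<Rightarrow> ('v, 'k) mpoly \<Rightarrow> ('v, 'k) mpoly \<Rightarrow> bool"
    where
  "complete_reduction lt G p q \<longleftrightarrow> (reduces lt G)\<^sup>*\<^sup>* p q \<and> (\<nexists>q'. reduces lt G q q')"


section \<open>The construction of the ideal h0\<close>

text \<open>
  The variable $x_i$ is named by the natural number $i$; thus $K[x_0,\dots,x_{n-1}]$ and
  $K[x_0,\dots,x_n]$ are the rings for the variable sets \<open>{..<n}\<close> and \<open>{..n}\<close>. The new variable
  $C_{\alpha\gamma}$ is named by the pair $(\alpha,\gamma)$. The elements of $K[C][x_0,\dots,x_n]$
  are represented as polynomials over $K$ in both kinds of variables, where \<open>Inl i\<close>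
  is $x_i$ and \<open>Inr (\<alpha>, \<gamma>)\<close> is $C_{\alpha\gamma}$.
\<close>

type_synonym cvar = "nat trm \<times> nat trm"

definition prec_n :: "nat \<Rightarrow> (nat trm \<Rightarrow> nat trm \<Rightarrow> bool) \<Rightarrow> nat trm \<Rightarrow> nat trm \<Rightarrow> bool" where
  "prec_n n prec s t \<longleftrightarrow>
     tdeg s < tdeg t \<or>
     (tdeg s = tdeg t \<and>
       (Poly_Mapping.lookup s n > Poly_Mapping.lookup t n \<or>
        (Poly_Mapping.lookup s n = Poly_Mapping.lookup t n \<and>
         prec (s - Poly_Mapping.single n (Poly_Mapping.lookup s n))
              (t - Poly_Mapping.single n (Poly_Mapping.lookup t n)))))"

definition x_part :: "(nat + cvar) trm \<Rightarrow> nat trm" where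
  "x_part t = Poly_Mapping.map_key Inl t"

definition C_part :: "(nat + cvar) trm \<Rightarrow> cvar trm" where
  "C_part t = Poly_Mapping.map_key Inr t"

definition elim_order ::
    "nat \<Rightarrow> (nat trm \<Rightarrow> nat trm \<Rightarrow> bool) \<Rightarrow> (cvar trm \<Rightarrow> cvar trm \<Rightarrow> bool)
     \<Rightarrow> (nat + cvar) trm \<Rightarrow> (nat + cvar) trm \<Rightarrow> bool" where
  "elim_order n prec precC s t \<longleftrightarrow>
     prec_n n prec (x_part s) (x_part t) \<or>
     (x_part s = x_part t \<and> precC (C_part s) (C_part t))"

definition x_coeff :: "nat trm \<Rightarrow> (nat + cvar, 'k::field) mpoly \<Rightarrow> (cvar, 'k) mpoly" where
  "x_coeff b p =
     (\<Sum>t\<in>{t\<in>Poly_Mapping.keys p. x_part t = b}.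
        Poly_Mapping.single (C_part t) (Poly_Mapping.lookup p t))"

definition min_gens ::
    "nat \<Rightarrow> (nat trm \<Rightarrow> nat trm \<Rightarrow> bool) \<Rightarrow> (nat, 'k::field) mpoly set \<Rightarrow> nat trm set" where
  "min_gens n prec H =
     {a. Poly_Mapping.single a 1 \<in> head_ideal {..<n} prec H \<and>
         (\<forall>b. Poly_Mapping.single b 1 \<in> head_ideal {..<n} prec H \<and> term_dvd b a \<longrightarrow> b = a)}"

definition normal_terms ::
    "nat \<Rightarrow> (nat trm \<Rightarrow> nat trm \<Rightarrow> bool) \<Rightarrow> (nat, 'k::field) mpoly set \<Rightarrow> nat \<Rightarrow> nat trm set" where
  "normal_terms n prec H d =
     {t \<in> terms {..n}. tdeg t = d \<and>
        Poly_Mapping.single t 1 \<notin> Idl\<^bsub>poly_ring {..n}\<^esub> (head_ideal {..<n} prec H)}"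

definition tail_exps ::
    "nat \<Rightarrow> (nat trm \<Rightarrow> nat trm \<Rightarrow> bool) \<Rightarrow> (nat, 'k::field) mpoly set \<Rightarrow> nat trm \<Rightarrow> nat trm set" where
  "tail_exps n prec H a =
     {c \<in> terms {..n}. Poly_Mapping.single n 1 + c \<in> normal_terms n prec H (tdeg a)}"

definition C_vars ::
    "nat \<Rightarrow> (nat trm \<Rightarrow> nat trm \<Rightarrow> bool) \<Rightarrow> (nat, 'k::field) mpoly set \<Rightarrow> cvar set" where
  "C_vars n prec H = {(a, c). a \<in> min_gens n prec H \<and> c \<in> tail_exps n prec H a}"

definition g_poly ::
    "nat \<Rightarrow> (nat trm \<Rightarrow> nat trm \<Rightarrow> bool) \<Rightarrow> (nat, 'k::field) mpoly set \<Rightarrow> nat trm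
     \<Rightarrow> (nat + cvar, 'k) mpoly" where
  "g_poly n prec H a =
     (\<Sum>c\<in>tail_exps n prec H a.
        Poly_Mapping.single
          (Poly_Mapping.single (Inr (a, c)) 1 + push Inl (Poly_Mapping.single n 1 + c)) 1)"

definition fg_poly ::
    "nat \<Rightarrow> (nat trm \<Rightarrow> nat trm \<Rightarrow> bool) \<Rightarrow> (nat, 'k::field) mpoly set
     \<Rightarrow> (nat trm \<Rightarrow> (nat, 'k) mpoly) \<Rightarrow> nat trm \<Rightarrow> (nat + cvar, 'k) mpoly" where
  "fg_poly n prec H f a = push (push Inl) (f a) + g_poly n prec H a"

text \<open>
  The construction involves a choice of a term order \<open>precC\<close> on the terms in $C$ and of complete
  reductions \<open>r a b\<close> of the S-polynomials. \<open>is_h0 n prec H h\<close> says that \<open>h\<close> is the outcome for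
  some admissible choice, so a statement about every such \<open>h\<close> covers all choices.
\<close>

definition is_h0 ::
    "nat \<Rightarrow> (nat trm \<Rightarrow> nat trm \<Rightarrow> bool) \<Rightarrow> (nat, 'k::field) mpoly set \<Rightarrow> (cvar, 'k) mpoly set
     \<Rightarrow> bool" where
  "is_h0 n prec H h \<longleftrightarrow>
     (\<exists>f precC r.
        (let M = min_gens n prec H;
             ord = elim_order n prec precC;
             F = fg_poly n prec H f
         in reduced_groebner_basis {..<n} prec H (f ` M) \<and>
            (\<forall>a\<in>M. head_term prec (f a) = a) \<and>
            term_order (C_vars n prec H) precC \<and>
            (\<forall>a\<in>M. \<forall>b\<in>M. complete_reduction ord (F ` M) (S_poly ord (F a) (F b)) (r a b)) \<and>
            h = Idl\<^bsub>poly_ring (C_vars n prec H)\<^esub>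
                  {x_coeff t (r a b) | t a b. t \<in> terms {..n} \<and> a \<in> M \<and> b \<in> M}))"

definition omega :: "nat \<Rightarrow> cvar \<Rightarrow> nat" where
  "omega n = (\<lambda>(a, c). Poly_Mapping.lookup c n + 1)"

end

theory Submission
  imports Defs
begin

text \<open>
  Grade the terms in \<open>x\<^sub>0, \<dots>, x\<^sub>n\<close> and \<open>C\<close> by giving \<open>C\<^sub>\<alpha>\<^sub>\<gamma>\<close> its weight
  \<open>\<gamma>\<^sub>n + 1\<close>, giving \<open>x\<^sub>n\<close> the weight \<open>-1\<close>, and giving all other \<open>x\<^sub>i\<close> the weight \<open>0\<close>.
  Then every \<open>f\<^sub>\<alpha> + g\<^sub>\<alpha>\<close> is homogeneous of weight \<open>0\<close>: the variable \<open>x\<^sub>n\<close> does not occur in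
  \<open>f\<^sub>\<alpha>\<close>, and in the term \<open>C\<^sub>\<alpha>\<^sub>\<gamma> x\<^sub>n x\<^sup>\<gamma>\<close> the weight of \<open>C\<^sub>\<alpha>\<^sub>\<gamma>\<close> cancels the
  \<open>\<gamma>\<^sub>n + 1\<close> factors \<open>x\<^sub>n\<close>. Forming an S-polynomial and reducing by homogeneous polynomials
  keep a polynomial homogeneous (\<open>S_poly_homogeneous\<close>, \<open>complete_reduction_homogeneous\<close>).
  So each complete reduction is homogeneous of some weight \<open>d\<close>, and in it the coefficient of a
  term \<open>x\<^sup>\<beta>\<close> is homogeneous of weight \<open>d + \<beta>\<^sub>n\<close> in \<open>K[C]\<close>. Hence the ideal has homogeneous
  generators, and such an ideal is homogeneous (\<open>homogeneous_ideal_genideal\<close>).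

  The weight of \<open>x\<^sub>n\<close> is negative, so the grading takes values in the integers. Homogeneity
  survives a reduction step only if the head term of the reducing polynomial really occurs in
  it. This is where the term orders enter: they make the elimination order total, so that a
  nonzero polynomial has a largest term.
\<close>


section \<open>Supports and weights\<close>

lemma keys_minus_subset:
  fixes p q :: "'a \<Rightarrow>\<^sub>0 'b::ab_group_add"
  shows "Poly_Mapping.keys (p - q) \<subseteq> Poly_Mapping.keys p \<union> Poly_Mapping.keys q"
  by (auto simp: in_keys_iff lookup_minus)

lemma keys_single_mult:
  "Poly_Mapping.keys (Poly_Mapping.single t c * p) \<subseteq> (+) t ` Poly_Mapping.keys p"
  using keys_mult[of "Poly_Mapping.single t c" p] by (auto split: if_splits)

lemma keys_add_nat:
  fixes s t :: "'v trm"
  shows "Poly_Mapping.keys (s + t) = Poly_Mapping.keys s \<union> Poly_Mapping.keys t"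
  by (auto simp: in_keys_iff lookup_add)

lemma terms_add [simp]: "s + t \<in> terms V \<longleftrightarrow> s \<in> terms V \<and> t \<in> terms V"
  by (simp add: terms_def keys_add_nat)

lemma terms_zero [simp]: "0 \<in> terms V"
  by (simp add: terms_def)

lemma terms_diff: "t \<in> terms V \<Longrightarrow> t - s \<in> terms V"
  by (auto simp: terms_def in_keys_iff lookup_minus)

lemma term_dvd_diff_add: "term_dvd s t \<Longrightarrow> (t - s) + s = t"
  by (rule poly_mapping_eqI) (simp add: term_dvd_def lookup_add lookup_minus)

lemma term_dvd_lcm: "term_dvd s (term_lcm s t)" "term_dvd t (term_lcm s t)"
  by (auto simp: term_dvd_def term_lcm_def lookup_add lookup_minus)

lemma weight_superset:
  assumes "finite A" "Poly_Mapping.keys t \<subseteq> A"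
  shows "weight w t = (\<Sum>v\<in>A. w v * Poly_Mapping.lookup t v)"
  unfolding weight_def by (rule sum.mono_neutral_left) (use assms in \<open>auto simp: in_keys_iff\<close>)

lemma weight_add: "weight w (s + t) = weight w s + weight w t"
proof -
  let ?A = "Poly_Mapping.keys s \<union> Poly_Mapping.keys t"
  have "weight w (s + t) = (\<Sum>v\<in>?A. w v * Poly_Mapping.lookup (s + t) v)"
    by (rule weight_superset) (auto simp: keys_add_nat)
  also have "\<dots> = (\<Sum>v\<in>?A. w v * Poly_Mapping.lookup s v) + (\<Sum>v\<in>?A. w v * Poly_Mapping.lookup t v)"
    by (simp add: lookup_add distrib_left sum.distrib)
  also have "\<dots> = weight w s + weight w t"
    by (subst (1 2) weight_superset[where A = ?A]) auto
  finally show ?thesis .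
qed

lemma weight_zero [simp]: "weight w 0 = 0"
  by (simp add: weight_def)

lemma weight_single [simp]: "weight w (Poly_Mapping.single v k) = w v * k"
  by (simp add: weight_def)

lemma lookup_push:
  "Poly_Mapping.lookup (push f p) b = (\<Sum>a\<in>Poly_Mapping.keys p. Poly_Mapping.lookup p a when f a = b)"
  by (simp add: push_def lookup_sum lookup_single)

lemma lookup_push_inj:
  assumes "inj f"
  shows "Poly_Mapping.lookup (push f p) (f a) = Poly_Mapping.lookup p a"
proof -
  have "Poly_Mapping.lookup (push f p) (f a)
      = (\<Sum>b\<in>Poly_Mapping.keys p. if a = b then Poly_Mapping.lookup p b else 0)"
    unfolding lookup_push by (rule sum.cong) (use assms in \<open>auto simp: when_def dest: injD\<close>)
  also have "\<dots> = Poly_Mapping.lookup p a"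
    by (simp add: in_keys_iff)
  finally show ?thesis .
qed

lemma keys_push: "Poly_Mapping.keys (push f p) \<subseteq> f ` Poly_Mapping.keys p"
  unfolding push_def by (rule order_trans[OF keys_sum]) auto

lemma lookup_component:
  "Poly_Mapping.lookup (component w d p) t = (Poly_Mapping.lookup p t when weight w t = d)"
proof -
  have "Poly_Mapping.lookup (component w d p) t
      = (\<Sum>s\<in>{s\<in>Poly_Mapping.keys p. weight w s = d}. if s = t then Poly_Mapping.lookup p s else 0)"
    by (simp add: component_def lookup_sum lookup_single when_def)
  also have "\<dots> = (Poly_Mapping.lookup p t when weight w t = d)"
    by (auto simp: sum.delta when_def in_keys_iff)
  finally show ?thesis .
qed

lemma component_zero [simp]: "component w d 0 = 0"
  by (rule poly_mapping_eqI) (simp add: lookup_component)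

lemma component_add: "component w d (p + q) = component w d p + component w d q"
  by (rule poly_mapping_eqI) (simp add: lookup_component lookup_add when_add_distrib)

lemma component_sum: "component w d (sum p A) = (\<Sum>a\<in>A. component w d (p a))"
  by (induction A rule: infinite_finite_induct) (auto simp: component_add)

lemma component_homogeneous:
  assumes "\<forall>t\<in>Poly_Mapping.keys p. weight w t = e"
  shows "component w d p = (if d = e then p else 0)"
  by (rule poly_mapping_eqI)
     (use assms in \<open>auto simp: lookup_component when_def in_keys_iff\<close>)

lemma sum_of_monomials:
  "p = (\<Sum>t\<in>Poly_Mapping.keys p. Poly_Mapping.single t (Poly_Mapping.lookup p t))"
  by (rule poly_mapping_eqI) (auto simp: lookup_sum lookup_single when_def in_keys_iff)

lemma sum_of_components:
  "p = (\<Sum>d\<in>weight w ` Poly_Mapping.keys p. component w d p)"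
  by (rule poly_mapping_eqI) (auto simp: lookup_sum lookup_component when_def in_keys_iff)

lemma component_monomial_mult:
  "component w d (Poly_Mapping.single t c * p)
     = (if weight w t \<le> d then Poly_Mapping.single t c * component w (d - weight w t) p else 0)"
proof -
  have hom: "\<forall>s\<in>Poly_Mapping.keys (Poly_Mapping.single t c * component w e p). weight w s = weight w t + e" for e
    using keys_single_mult[of t c "component w e p"]
    by (auto simp: weight_add in_keys_iff lookup_component)
  let ?D = "weight w ` Poly_Mapping.keys p"
  have "component w d (Poly_Mapping.single t c * p)
      = component w d (\<Sum>e\<in>?D. Poly_Mapping.single t c * component w e p)"
    by (subst sum_of_components[of p w]) (simp add: sum_distrib_left)
  also have "\<dots> = (\<Sum>e\<in>?D. if d = weight w t + e then Poly_Mapping.single t c * component w e p else 0)"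
    unfolding component_sum by (rule sum.cong) (auto simp: component_homogeneous[OF hom])
  also have "\<dots> = (\<Sum>e\<in>?D. if e = d - weight w t
      then (if weight w t \<le> d then Poly_Mapping.single t c * component w e p else 0) else 0)"
    by (rule sum.cong) auto
  also have "\<dots> = (if weight w t \<le> d then Poly_Mapping.single t c * component w (d - weight w t) p else 0)"
  proof (cases "d - weight w t \<in> ?D")
    case False
    then have "component w (d - weight w t) p = 0"
      by (intro poly_mapping_eqI) (use False in \<open>force simp: lookup_component when_def in_keys_iff\<close>)
    with False show ?thesis by (simp add: sum.delta)
  qed (simp add: sum.delta)
  finally show ?thesis .
qed


section \<open>Ideals with homogeneous generators\<close>

lemma carrier_poly_ring_add:
  "p \<in> carrier (poly_ring V) \<Longrightarrow> q \<in> carrier (poly_ring V) \<Longrightarrow> p + q \<in> carrier (poly_ring V)"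
  using keys_add[of p q] by (auto simp: poly_ring_def)

lemma carrier_poly_ring_mult:
  "p \<in> carrier (poly_ring V) \<Longrightarrow> q \<in> carrier (poly_ring V) \<Longrightarrow> p * q \<in> carrier (poly_ring V)"
  using keys_mult[of p q] by (fastforce simp: poly_ring_def)

lemma carrier_poly_ring_uminus:
  "p \<in> carrier (poly_ring V) \<Longrightarrow> - p \<in> carrier (poly_ring V)"
  by (auto simp: poly_ring_def in_keys_iff subset_iff)

lemma poly_ring_simps [simp]:
  "mult (poly_ring V) = (*)" "one (poly_ring V) = 1" "zero (poly_ring V) = 0" "add (poly_ring V) = (+)"
  by (simp_all add: poly_ring_def)

lemma ring_poly_ring: "ring (poly_ring V :: ('v, 'k::field) mpoly ring)"
proof -
  let ?R = "poly_ring V :: ('v, 'k) mpoly ring"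
  have one: "1 \<in> carrier ?R" and zero: "0 \<in> carrier ?R"
    by (auto simp: poly_ring_def)
  have "abelian_group ?R"
  proof (rule abelian_groupI)
    fix p assume "p \<in> carrier ?R"
    then show "\<exists>q\<in>carrier ?R. q \<oplus>\<^bsub>?R\<^esub> p = \<zero>\<^bsub>?R\<^esub>"
      by (intro bexI[of _ "- p"] carrier_poly_ring_uminus) simp_all
  qed (simp_all add: zero carrier_poly_ring_add ac_simps)
  moreover have "comm_monoid ?R"
    by (rule comm_monoidI) (simp_all add: one carrier_poly_ring_mult ac_simps)
  ultimately have "cring ?R"
    by (rule cringI) (simp add: distrib_right)
  then show ?thesis by (rule cring.axioms)
qed

lemma a_inv_poly_ring:
  assumes "p \<in> carrier (poly_ring V)"
  shows "inv\<^bsub>add_monoid (poly_ring V)\<^esub> p = - p"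
proof -
  interpret ring "poly_ring V" by (rule ring_poly_ring)
  show ?thesis
    using minus_equality[of "- p" p] assms carrier_poly_ring_uminus[OF assms]
    by (simp add: a_inv_def)
qed

lemma poly_ring_idealI:
  assumes "I \<subseteq> carrier (poly_ring V)" "0 \<in> I"
    and add: "\<And>p q. p \<in> I \<Longrightarrow> q \<in> I \<Longrightarrow> p + q \<in> I"
    and mult: "\<And>r p. r \<in> carrier (poly_ring V) \<Longrightarrow> p \<in> I \<Longrightarrow> r * p \<in> I"
  shows "ideal I (poly_ring V)"
proof (rule idealI[OF ring_poly_ring])
  have "- p \<in> I" if "p \<in> I" for p
    using mult[OF carrier_poly_ring_uminus that, of 1] by (simp add: poly_ring_def)
  then have "inv\<^bsub>add_monoid (poly_ring V)\<^esub> p \<in> I" if "p \<in> I" for p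
    using that assms(1) a_inv_poly_ring[of p V] by auto
  then show "subgroup I (add_monoid (poly_ring V))"
    using assms(1,2) add by (intro subgroup.intro) auto
  show "x \<otimes>\<^bsub>poly_ring V\<^esub> p \<in> I" "p \<otimes>\<^bsub>poly_ring V\<^esub> x \<in> I"
    if "p \<in> I" "x \<in> carrier (poly_ring V)" for p x
    using mult[OF that(2,1)] by (simp_all add: mult.commute)
qed

lemma ideal_sum_closed:
  assumes "ideal I (poly_ring V)" "\<And>a. a \<in> A \<Longrightarrow> p a \<in> I"
  shows "sum p A \<in> I"
proof -
  interpret ideal I "poly_ring V" by fact
  have "0 \<in> I" and "\<And>x y. x \<in> I \<Longrightarrow> y \<in> I \<Longrightarrow> x + y \<in> I"
    using additive_subgroup.zero_closed[OF additive_subgroup_axioms]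
      additive_subgroup.a_closed[OF additive_subgroup_axioms]
    by auto
  with assms(2) show ?thesis
    by (induction A rule: infinite_finite_induct) auto
qed

text \<open>
  The elements of the ideal whose components all lie in the ideal form an ideal themselves, and
  this ideal contains the generators. Closure under multiplication needs to be checked for
  monomials only, and these merely shift the components.
\<close>

lemma homogeneous_ideal_genideal:
  assumes S: "S \<subseteq> carrier (poly_ring V)"
    and hom: "\<And>p. p \<in> S \<Longrightarrow> \<exists>d. \<forall>t\<in>Poly_Mapping.keys p. weight w t = d"
  shows "homogeneous_ideal V w (Idl\<^bsub>poly_ring V\<^esub> S)"
proof -
  interpret ring "poly_ring V" by (rule ring_poly_ring)
  let ?I = "Idl\<^bsub>poly_ring V\<^esub> S"
  have I: "ideal ?I (poly_ring V)" using S by (rule genideal_ideal)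
  interpret I: ideal ?I "poly_ring V" by (rule I)
  have I_zero: "0 \<in> ?I"
    using additive_subgroup.zero_closed[OF I.additive_subgroup_axioms] by simp
  have I_add: "p + q \<in> ?I" if "p \<in> ?I" "q \<in> ?I" for p q
    using additive_subgroup.a_closed[OF I.additive_subgroup_axioms that] by simp
  have I_mult: "r * p \<in> ?I" if "r \<in> carrier (poly_ring V)" "p \<in> ?I" for r p
    using I.I_l_closed[OF that(2,1)] by simp
  define J where "J = {p \<in> ?I. \<forall>d. component w d p \<in> ?I}"
  have "ideal J (poly_ring V)"
  proof (rule poly_ring_idealI)
    show "J \<subseteq> carrier (poly_ring V)" using I.Icarr by (auto simp: J_def)
    show "0 \<in> J" by (simp add: J_def I_zero)
    show "p + q \<in> J" if "p \<in> J" "q \<in> J" for p q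
      using that by (auto simp: J_def component_add I_add)
    show "r * p \<in> J" if r: "r \<in> carrier (poly_ring V)" and p: "p \<in> J" for r p
    proof -
      have "component w d (r * p) \<in> ?I" for d
      proof -
        have "component w d (r * p) = component w d
            (\<Sum>t\<in>Poly_Mapping.keys r. Poly_Mapping.single t (Poly_Mapping.lookup r t) * p)"
          by (subst sum_of_monomials[of r]) (simp add: sum_distrib_right)
        also have "\<dots> \<in> ?I"
          unfolding component_sum component_monomial_mult
        proof (rule ideal_sum_closed[OF I])
          fix t assume "t \<in> Poly_Mapping.keys r"
          with r have "Poly_Mapping.single t (Poly_Mapping.lookup r t) \<in> carrier (poly_ring V)"
            by (auto simp: poly_ring_def)
          then show "(if weight w t \<le> d
              then Poly_Mapping.single t (Poly_Mapping.lookup r t) * component w (d - weight w t) p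
              else 0) \<in> ?I"
            using p I_mult I_zero by (auto simp: J_def)
        qed
        finally show ?thesis .
      qed
      with p r I_mult show ?thesis by (auto simp: J_def)
    qed
  qed
  moreover have "S \<subseteq> J"
  proof
    fix p assume p: "p \<in> S"
    then obtain e where e: "\<forall>t\<in>Poly_Mapping.keys p. weight w t = e" using hom by blast
    have "p \<in> ?I" using genideal_self[OF S] p by blast
    then show "p \<in> J" by (simp add: J_def component_homogeneous[OF e] I_zero)
  qed
  ultimately have "?I \<subseteq> J" by (rule genideal_minimal)
  then show ?thesis using I by (auto simp: homogeneous_ideal_def J_def)
qed


section \<open>Head terms\<close>

definition strict_total_on :: "'a set \<Rightarrow> ('a \<Rightarrow> 'a \<Rightarrow> bool) \<Rightarrow> bool" where
  "strict_total_on T lt \<longleftrightarrow> irreflp_on T lt \<and> transp_on T lt \<and> totalp_on T lt"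

lemma head_term_in_keys:
  assumes lt: "strict_total_on T lt" and p: "Poly_Mapping.keys p \<subseteq> T" "p \<noteq> 0"
  shows "head_term lt p \<in> Poly_Mapping.keys p"
proof -
  let ?A = "Poly_Mapping.keys p"
  have A: "transp_on ?A lt" "totalp_on ?A lt" "irreflp_on ?A lt"
    using lt p(1) unfolding strict_total_on_def
    by (simp_all add: transp_on_subset[of T] totalp_on_subset[of T] irreflp_on_subset[of T])
  have asym: "asymp_on ?A lt"
    using A(3) asymp_on_iff_irreflp_on_if_transp_on[OF A(1)] by simp
  have "?A \<noteq> {}" using p(2) by simp
  from Finite_Set.bex_greatest_element[OF finite_keys this A(1,2)]
  obtain t where t: "t \<in> ?A" "\<forall>s\<in>?A. s \<noteq> t \<longrightarrow> lt s t" by blast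
  have "\<exists>!t. t \<in> ?A \<and> (\<forall>s\<in>?A. s \<noteq> t \<longrightarrow> lt s t)"
  proof (rule ex1I[of _ t])
    fix u assume "u \<in> ?A \<and> (\<forall>s\<in>?A. s \<noteq> u \<longrightarrow> lt s u)"
    with t show "u = t" using asymp_onD[OF asym, of u t] by metis
  qed (use t in simp)
  from theI'[OF this] show ?thesis by (simp add: head_term_def)
qed

lemma lookup_x_part: "Poly_Mapping.lookup (x_part t) i = Poly_Mapping.lookup t (Inl i)"
  by (simp add: x_part_def map_key.rep_eq)

lemma lookup_C_part: "Poly_Mapping.lookup (C_part t) c = Poly_Mapping.lookup t (Inr c)"
  by (simp add: C_part_def map_key.rep_eq)

lemma x_part_add: "x_part (s + t) = x_part s + x_part t"
  by (simp add: x_part_def map_key_plus)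

lemma C_part_add: "C_part (s + t) = C_part s + C_part t"
  by (simp add: C_part_def map_key_plus)

lemma x_part_diff: "x_part (s - t) = x_part s - x_part t"
  by (rule poly_mapping_eqI) (simp add: lookup_x_part lookup_C_part lookup_minus)

lemma C_part_diff: "C_part (s - t) = C_part s - C_part t"
  by (rule poly_mapping_eqI) (simp add: lookup_x_part lookup_C_part lookup_minus)

lemma x_part_push [simp]: "x_part (push Inl s) = s"
  by (rule poly_mapping_eqI) (simp add: lookup_x_part lookup_C_part lookup_push_inj)

lemma C_part_push [simp]: "C_part (push Inl s) = 0"
  by (rule poly_mapping_eqI) (simp add: lookup_x_part lookup_C_part lookup_push)

lemma x_part_single_Inr [simp]: "x_part (Poly_Mapping.single (Inr c) k) = 0"
  by (rule poly_mapping_eqI) (simp add: lookup_x_part lookup_C_part lookup_single)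

lemma C_part_single_Inr [simp]: "C_part (Poly_Mapping.single (Inr c) k) = Poly_Mapping.single c k"
  by (simp add: C_part_def)

lemma term_eqI:
  assumes "x_part s = x_part t" "C_part s = C_part t"
  shows "s = t"
proof (rule poly_mapping_eqI)
  fix v
  show "Poly_Mapping.lookup s v = Poly_Mapping.lookup t v"
    using lookup_x_part[of s] lookup_x_part[of t] lookup_C_part[of s] lookup_C_part[of t] assms
    by (cases v) metis+
qed

lemma terms_remove_variable:
  fixes t :: "nat trm"
  assumes "t \<in> terms {..n}"
  shows "t - Poly_Mapping.single n (Poly_Mapping.lookup t n) \<in> terms {..<n}"
  unfolding terms_def
proof (intro CollectI subsetI)
  fix v assume v: "v \<in> Poly_Mapping.keys (t - Poly_Mapping.single n (Poly_Mapping.lookup t n))"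
  then have "v \<noteq> n" by (auto simp: in_keys_iff lookup_minus)
  moreover from v have "v \<in> Poly_Mapping.keys t" by (auto simp: in_keys_iff lookup_minus)
  then have "v \<le> n" using assms by (auto simp: terms_def)
  ultimately show "v \<in> {..<n}" by simp
qed

lemma remove_variable_inject:
  fixes s t :: "nat trm"
  assumes "Poly_Mapping.lookup s n = Poly_Mapping.lookup t n"
    and "s - Poly_Mapping.single n (Poly_Mapping.lookup s n) = t - Poly_Mapping.single n (Poly_Mapping.lookup t n)"
  shows "s = t"
proof (rule poly_mapping_eqI)
  fix v
  show "Poly_Mapping.lookup s v = Poly_Mapping.lookup t v"
    using assms(1) arg_cong[OF assms(2), of "\<lambda>u. Poly_Mapping.lookup u v"]
    by (auto simp: lookup_minus lookup_single when_def split: if_splits)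
qed

lemma strict_total_on_prec_n:
  assumes "strict_total_on (terms {..<n}) prec"
  shows "strict_total_on (terms {..n}) (prec_n n prec)"
proof -
  have irr: "\<And>s. s \<in> terms {..<n} \<Longrightarrow> \<not> prec s s"
    and tr: "\<And>s t u. \<lbrakk>s \<in> terms {..<n}; t \<in> terms {..<n}; u \<in> terms {..<n}; prec s t; prec t u\<rbrakk> \<Longrightarrow> prec s u"
    and tot: "\<And>s t. \<lbrakk>s \<in> terms {..<n}; t \<in> terms {..<n}; s \<noteq> t\<rbrakk> \<Longrightarrow> prec s t \<or> prec t s"
    using assms unfolding strict_total_on_def irreflp_on_def transp_on_def totalp_on_def by blast+
  define T where "T s = s - Poly_Mapping.single n (Poly_Mapping.lookup s n)" for s :: "nat trm"
  have prec_n: "prec_n n prec s t \<longleftrightarrow> tdeg s < tdeg t \<or> tdeg s = tdeg t \<and>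
      (Poly_Mapping.lookup t n < Poly_Mapping.lookup s n \<or>
       Poly_Mapping.lookup s n = Poly_Mapping.lookup t n \<and> prec (T s) (T t))" for s t
    by (simp add: prec_n_def T_def)
  have T: "T s \<in> terms {..<n}" if "s \<in> terms {..n}" for s
    using that by (simp add: T_def terms_remove_variable)
  show ?thesis
    unfolding strict_total_on_def
  proof (intro conjI)
    show "irreflp_on (terms {..n}) (prec_n n prec)"
      using irr[OF T] by (simp add: irreflp_on_def prec_n)
    show "transp_on (terms {..n}) (prec_n n prec)"
    proof (rule transp_onI)
      fix s t u
      assume "s \<in> terms {..n}" "t \<in> terms {..n}" "u \<in> terms {..n}"
      from tr[OF this[THEN T]] show "prec_n n prec s u" if "prec_n n prec s t" "prec_n n prec t u"
        using that unfolding prec_n by (elim disjE conjE) simp_all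
    qed
    show "totalp_on (terms {..n}) (prec_n n prec)"
    proof (rule totalp_onI)
      fix s t assume st: "s \<in> terms {..n}" "t \<in> terms {..n}" "s \<noteq> t"
      show "prec_n n prec s t \<or> prec_n n prec t s"
      proof (cases "tdeg s = tdeg t \<and> Poly_Mapping.lookup s n = Poly_Mapping.lookup t n")
        case True
        with st(3) have "T s \<noteq> T t" using remove_variable_inject[of s n t] by (auto simp: T_def)
        with True show ?thesis using tot[OF T T, OF st(1,2)] by (simp add: prec_n)
      next
        case False
        then show ?thesis by (auto simp: prec_n)
      qed
    qed
  qed
qed

definition mixed_terms :: "nat \<Rightarrow> cvar set \<Rightarrow> (nat + cvar) trm set" where
  "mixed_terms n V = {t. x_part t \<in> terms {..n} \<and> C_part t \<in> terms V}"

lemma strict_total_on_elim_order: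
  assumes "strict_total_on (terms {..<n}) prec" "strict_total_on (terms V) precC"
  shows "strict_total_on (mixed_terms n V) (elim_order n prec precC)"
proof -
  let ?lt = "elim_order n prec precC"
  have P: "irreflp_on (terms {..n}) (prec_n n prec)" "transp_on (terms {..n}) (prec_n n prec)"
      "totalp_on (terms {..n}) (prec_n n prec)"
    using strict_total_on_prec_n[OF assms(1)] by (auto simp: strict_total_on_def)
  have C: "irreflp_on (terms V) precC" "transp_on (terms V) precC" "totalp_on (terms V) precC"
    using assms(2) by (auto simp: strict_total_on_def)
  show ?thesis
    unfolding strict_total_on_def
  proof (intro conjI)
    show "irreflp_on (mixed_terms n V) ?lt"
      using P(1) C(1) by (auto simp: irreflp_on_def elim_order_def mixed_terms_def)
    show "transp_on (mixed_terms n V) ?lt"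
      by (rule transp_onI)
         (auto simp: elim_order_def mixed_terms_def dest: transp_onD[OF P(2), rotated 3] transp_onD[OF C(2), rotated 3])
    show "totalp_on (mixed_terms n V) ?lt"
    proof (rule totalp_onI)
      fix s t assume st: "s \<in> mixed_terms n V" "t \<in> mixed_terms n V" "s \<noteq> t"
      then consider "x_part s \<noteq> x_part t" | "x_part s = x_part t" "C_part s \<noteq> C_part t"
        using term_eqI by blast
      then show "?lt s t \<or> ?lt t s"
        using st totalp_onD[OF P(3), of "x_part s" "x_part t"] totalp_onD[OF C(3), of "C_part s" "C_part t"]
        by cases (auto simp: elim_order_def mixed_terms_def)
    qed
  qed
qed


section \<open>The grading of the mixed terms\<close>

definition balance :: "nat \<Rightarrow> (nat + cvar) trm \<Rightarrow> int" where
  "balance n t = int (weight (omega n) (C_part t)) - int (Poly_Mapping.lookup (x_part t) n)"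

definition balanced :: "nat \<Rightarrow> cvar set \<Rightarrow> int \<Rightarrow> (nat + cvar) trm set" where
  "balanced n V d = {t \<in> mixed_terms n V. balance n t = d}"

lemma balance_add: "balance n (s + t) = balance n s + balance n t"
  by (simp add: balance_def x_part_add C_part_add weight_add lookup_add)

lemma mixed_terms_add: "s \<in> mixed_terms n V \<Longrightarrow> t \<in> mixed_terms n V \<Longrightarrow> s + t \<in> mixed_terms n V"
  by (simp add: mixed_terms_def x_part_add C_part_add)

lemma mixed_terms_diff: "t \<in> mixed_terms n V \<Longrightarrow> t - s \<in> mixed_terms n V"
  by (simp add: mixed_terms_def x_part_diff C_part_diff terms_diff)

lemma balanced_subset_mixed_terms: "balanced n V d \<subseteq> mixed_terms n V"
  by (auto simp: balanced_def)

text \<open>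
  S-polynomials and reduction steps both subtract multiples of this form, with \<open>s\<close> the head term
  of \<open>g\<close>. The cofactor \<open>t - s\<close> has the weight of \<open>t\<close>, since \<open>s\<close> has weight \<open>0\<close>.
\<close>

lemma balanced_cofactor_mult:
  assumes g: "Poly_Mapping.keys g \<subseteq> balanced n V 0" "s \<in> Poly_Mapping.keys g"
    and t: "t \<in> balanced n V d" "term_dvd s t"
  shows "Poly_Mapping.keys (Poly_Mapping.single (t - s) c * g) \<subseteq> balanced n V d"
proof -
  have "balance n (t - s) + balance n s = d"
    using t balance_add[of n "t - s" s] by (simp add: term_dvd_diff_add balanced_def)
  with g have "balance n (t - s) = d" by (auto simp: balanced_def)
  moreover have "t - s \<in> mixed_terms n V"
    using t(1) by (simp add: balanced_def mixed_terms_diff)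
  ultimately have "(+) (t - s) ` Poly_Mapping.keys g \<subseteq> balanced n V d"
    using g(1) by (auto simp: balanced_def balance_add mixed_terms_add subset_iff)
  with keys_single_mult show ?thesis by (rule order_trans)
qed

lemma S_poly_homogeneous:
  assumes lt: "strict_total_on (mixed_terms n V) lt"
    and p: "Poly_Mapping.keys p \<subseteq> balanced n V 0" "p \<noteq> 0"
    and q: "Poly_Mapping.keys q \<subseteq> balanced n V 0" "q \<noteq> 0"
  obtains d where "Poly_Mapping.keys (S_poly lt p q) \<subseteq> balanced n V d"
proof -
  let ?s = "head_term lt p" and ?t = "head_term lt q"
  let ?m = "term_lcm ?s ?t"
  have s: "?s \<in> Poly_Mapping.keys p" and t: "?t \<in> Poly_Mapping.keys q"
    by (rule head_term_in_keys[OF lt subset_trans[OF p(1) balanced_subset_mixed_terms] p(2)],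
        rule head_term_in_keys[OF lt subset_trans[OF q(1) balanced_subset_mixed_terms] q(2)])
  then have "?m \<in> mixed_terms n V"
    using subsetD[OF p(1)] subsetD[OF q(1)]
    by (simp add: term_lcm_def balanced_def mixed_terms_add mixed_terms_diff)
  then have m: "?m \<in> balanced n V (balance n ?m)" by (simp add: balanced_def)
  have "Poly_Mapping.keys (S_poly lt p q) \<subseteq> balanced n V (balance n ?m)"
    unfolding S_poly_def Let_def
    by (rule order_trans[OF keys_minus_subset], rule Un_least)
       (rule balanced_cofactor_mult[OF p(1) s m term_dvd_lcm(1)] balanced_cofactor_mult[OF q(1) t m term_dvd_lcm(2)])+
  then show thesis by (rule that)
qed

lemma reduces_homogeneous:
  assumes lt: "strict_total_on (mixed_terms n V) lt"
    and G: "\<And>g. g \<in> G \<Longrightarrow> Poly_Mapping.keys g \<subseteq> balanced n V 0"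
    and p: "Poly_Mapping.keys p \<subseteq> balanced n V d" and "reduces lt G p q"
  shows "Poly_Mapping.keys q \<subseteq> balanced n V d"
proof -
  from \<open>reduces lt G p q\<close> obtain g t where g: "g \<in> G" "g \<noteq> 0"
    and t: "t \<in> Poly_Mapping.keys p" "term_dvd (head_term lt g) t"
    and q: "q = p - Poly_Mapping.single (t - head_term lt g) (Poly_Mapping.lookup p t / head_coeff lt g) * g"
    unfolding reduces_def by blast
  have ht: "head_term lt g \<in> Poly_Mapping.keys g"
    by (rule head_term_in_keys[OF lt subset_trans[OF G[OF g(1)] balanced_subset_mixed_terms] g(2)])
  have "t \<in> balanced n V d" using p t(1) by blast
  from balanced_cofactor_mult[OF G[OF g(1)] ht this t(2)] show ?thesis
    unfolding q by (rule order_trans[OF keys_minus_subset Un_least[OF p]])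
qed

lemma complete_reduction_homogeneous:
  assumes lt: "strict_total_on (mixed_terms n V) lt"
    and G: "\<And>g. g \<in> G \<Longrightarrow> Poly_Mapping.keys g \<subseteq> balanced n V 0"
    and p: "Poly_Mapping.keys p \<subseteq> balanced n V d" and "complete_reduction lt G p q"
  shows "Poly_Mapping.keys q \<subseteq> balanced n V d"
proof -
  have "(reduces lt G)\<^sup>*\<^sup>* p q"
    using assms(4) by (simp add: complete_reduction_def)
  then show ?thesis
    by induction (use p reduces_homogeneous[OF lt G] in auto)
qed

lemma keys_x_coeff: "Poly_Mapping.keys (x_coeff b p) \<subseteq> C_part ` {t \<in> Poly_Mapping.keys p. x_part t = b}"
  unfolding x_coeff_def by (rule order_trans[OF keys_sum]) auto

lemma x_coeff_homogeneous:
  assumes "Poly_Mapping.keys p \<subseteq> balanced n V d"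
  shows "x_coeff b p \<in> carrier (poly_ring V)"
    and "\<exists>e. \<forall>t\<in>Poly_Mapping.keys (x_coeff b p). weight (omega n) t = e"
proof -
  have *: "t \<in> terms V \<and> int (weight (omega n) t) = d + int (Poly_Mapping.lookup b n)"
    if t: "t \<in> Poly_Mapping.keys (x_coeff b p)" for t
  proof -
    obtain s where "s \<in> Poly_Mapping.keys p" "x_part s = b" "t = C_part s"
      using t keys_x_coeff[of b p] by blast
    then show ?thesis using assms by (auto simp: balanced_def balance_def mixed_terms_def)
  qed
  then show "x_coeff b p \<in> carrier (poly_ring V)" by (auto simp: poly_ring_def)
  \<comment> \<open>The sum below can only be negative when the coefficient is zero, and then any \<open>e\<close> will do.\<close>
  show "\<exists>e. \<forall>t\<in>Poly_Mapping.keys (x_coeff b p). weight (omega n) t = e"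
    by (rule exI[of _ "nat (d + int (Poly_Mapping.lookup b n))"]) (use * in force)
qed


section \<open>Homogeneity of the ideal\<close>

lemma keys_g_poly:
  "Poly_Mapping.keys (g_poly n prec H a :: (nat + cvar, 'k::field) mpoly) \<subseteq>
     (\<lambda>c. Poly_Mapping.single (Inr (a, c)) 1 + push Inl (Poly_Mapping.single n 1 + c)) ` tail_exps n prec H a"
  unfolding g_poly_def by (rule order_trans[OF keys_sum]) auto

text \<open>
  The exponent of \<open>x\<^sub>n\<close> is \<open>0\<close> in a term of \<open>f a\<close>. In the term of \<open>g\<close> that belongs to
  \<open>(a, c)\<close> it exceeds the exponent in \<open>c\<close> by one, because of the extra factor \<open>x\<^sub>n\<close>; the
  summand \<open>1\<close> in \<open>omega\<close> makes up for that factor.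
\<close>

lemma fg_poly_homogeneous:
  assumes "a \<in> min_gens n prec H" and f: "f a \<in> carrier (poly_ring {..<n})"
  shows "Poly_Mapping.keys (fg_poly n prec H f a) \<subseteq> balanced n (C_vars n prec H) 0"
proof -
  have "push Inl t \<in> balanced n (C_vars n prec H) 0" if "t \<in> Poly_Mapping.keys (f a)" for t
  proof -
    have "Poly_Mapping.keys t \<subseteq> {..<n}" using that f by (auto simp: poly_ring_def terms_def)
    then have "t \<in> terms {..n}" "Poly_Mapping.lookup t n = 0"
      by (auto simp: terms_def in_keys_iff)
    then show ?thesis by (simp add: balanced_def balance_def mixed_terms_def)
  qed
  moreover have "Poly_Mapping.single (Inr (a, c)) 1 + push Inl (Poly_Mapping.single n 1 + c)
      \<in> balanced n (C_vars n prec H) 0" if "c \<in> tail_exps n prec H a" for c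
  proof -
    have "c \<in> terms {..n}" "(a, c) \<in> C_vars n prec H"
      using that assms(1) by (auto simp: tail_exps_def C_vars_def)
    then show ?thesis
      by (auto simp: balanced_def balance_def mixed_terms_def x_part_add C_part_add lookup_add
          omega_def terms_def keys_add_nat)
  qed
  ultimately show ?thesis
    unfolding fg_poly_def
    using keys_add[of "push (push Inl) (f a)" "g_poly n prec H a"]
      keys_push[of "push Inl" "f a"] keys_g_poly[of n prec H a] by blast
qed

text \<open>
  The two summands have disjoint supports: the terms of the first contain no variable of \<open>C\<close>,
  those of the second contain one.
\<close>

lemma fg_poly_nonzero:
  assumes "f a \<noteq> 0"
  shows "fg_poly n prec H f a \<noteq> 0"
proof -
  obtain s where s: "s \<in> Poly_Mapping.keys (f a)" using assms by fastforce
  have "inj (push Inl :: nat trm \<Rightarrow> (nat + cvar) trm)"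
    by (rule inj_on_inverseI[of _ x_part]) simp
  then have "Poly_Mapping.lookup (push (push Inl) (f a)) (push Inl s :: (nat + cvar) trm)
      = Poly_Mapping.lookup (f a) s"
    by (rule lookup_push_inj)
  moreover have "push Inl s \<notin> Poly_Mapping.keys (g_poly n prec H a)"
  proof
    assume "push Inl s \<in> Poly_Mapping.keys (g_poly n prec H a)"
    then obtain c where "push Inl s = Poly_Mapping.single (Inr (a, c)) 1 + push Inl (Poly_Mapping.single n 1 + c)"
      using keys_g_poly by blast
    from arg_cong[OF this, of C_part] have "Poly_Mapping.single (a, c) (1::nat) = 0"
      by (simp add: C_part_add)
    then have "Poly_Mapping.lookup (Poly_Mapping.single (a, c) (1::nat)) (a, c) = 0" by simp
    then show False by simp
  qed
  ultimately have "Poly_Mapping.lookup (fg_poly n prec H f a) (push Inl s) \<noteq> 0"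
    using s by (simp add: fg_poly_def lookup_add in_keys_iff)
  then show ?thesis by auto
qed

theorem proposition6p4:
  fixes n :: nat
    and prec :: "nat trm \<Rightarrow> nat trm \<Rightarrow> bool"
    and H :: "(nat, 'k::field) mpoly set"
    and h0 :: "(cvar, 'k) mpoly set"
  assumes "infinite (UNIV :: 'k set)"
    and "homogeneous_ideal {..<n} (\<lambda>_. 1) H"
    and "term_order {..<n} prec"
    and "is_h0 n prec H h0"
  shows "homogeneous_ideal (C_vars n prec H) (omega n) h0"
proof -
  let ?V = "C_vars n prec H" and ?M = "min_gens n prec H"
  obtain f precC r where gb: "reduced_groebner_basis {..<n} prec H (f ` ?M)"
    and precC: "term_order ?V precC"
    and red: "\<forall>a\<in>?M. \<forall>b\<in>?M. complete_reduction (elim_order n prec precC) (fg_poly n prec H f ` ?M)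
        (S_poly (elim_order n prec precC) (fg_poly n prec H f a) (fg_poly n prec H f b)) (r a b)"
    and h0: "h0 = Idl\<^bsub>poly_ring ?V\<^esub> {x_coeff t (r a b) | t a b. t \<in> terms {..n} \<and> a \<in> ?M \<and> b \<in> ?M}"
    using assms(4) unfolding is_h0_def Let_def
  proof (elim exE conjE, goal_cases)
    case (1 f precC r)
    then show ?case by (intro 1(1)[of f precC r])
  qed
  let ?lt = "elim_order n prec precC" and ?F = "fg_poly n prec H f"
  have lt: "strict_total_on (mixed_terms n ?V) ?lt"
    using assms(3) precC
    by (intro strict_total_on_elim_order) (auto simp: strict_total_on_def term_order_def)
  have H: "H \<subseteq> carrier (poly_ring {..<n})"
    using assms(2) by (auto simp: homogeneous_ideal_def intro: ideal.Icarr)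
  have f: "f a \<in> carrier (poly_ring {..<n})" "f a \<noteq> 0" if "a \<in> ?M" for a
  proof -
    have "f ` ?M \<subseteq> H" "0 \<notin> f ` ?M"
      using gb by (simp_all add: reduced_groebner_basis_def groebner_basis_def)
    with imageI[OF that, of f] have "f a \<in> H" and "f a \<noteq> 0" by auto
    with H show "f a \<in> carrier (poly_ring {..<n})" "f a \<noteq> 0" by auto
  qed
  have F: "Poly_Mapping.keys (?F a) \<subseteq> balanced n ?V 0" "?F a \<noteq> 0" if "a \<in> ?M" for a
    by (rule fg_poly_homogeneous[where f = f, OF that f(1)[OF that]],
        rule fg_poly_nonzero[where f = f, OF f(2)[OF that]])
  have r: "\<exists>d. Poly_Mapping.keys (r a b) \<subseteq> balanced n ?V d" if ab: "a \<in> ?M" "b \<in> ?M" for a b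
  proof -
    obtain d where "Poly_Mapping.keys (S_poly ?lt (?F a) (?F b)) \<subseteq> balanced n ?V d"
      by (rule S_poly_homogeneous[OF lt F[OF ab(1)] F[OF ab(2)]])
    moreover have "Poly_Mapping.keys g \<subseteq> balanced n ?V 0" if "g \<in> ?F ` ?M" for g
      using that F(1) by (elim imageE) simp
    ultimately have "Poly_Mapping.keys (r a b) \<subseteq> balanced n ?V d"
      by (rule complete_reduction_homogeneous[OF lt _ _ red[rule_format, OF ab], rotated])
    then show ?thesis ..
  qed
  show ?thesis
    unfolding h0
  proof (rule homogeneous_ideal_genideal)
    let ?S = "{x_coeff t (r a b) | t a b. t \<in> terms {..n} \<and> a \<in> ?M \<and> b \<in> ?M}"
    have *: "p \<in> carrier (poly_ring ?V) \<and> (\<exists>e. \<forall>t\<in>Poly_Mapping.keys p. weight (omega n) t = e)"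
      if "p \<in> ?S" for p
    proof -
      from that obtain t a b where p: "p = x_coeff t (r a b)" and "a \<in> ?M" "b \<in> ?M" by blast
      then obtain d where "Poly_Mapping.keys (r a b) \<subseteq> balanced n ?V d" using r by blast
      from x_coeff_homogeneous[OF this] show ?thesis unfolding p by (rule conjI)
    qed
    show "?S \<subseteq> carrier (poly_ring ?V)"
      using * by (intro subsetI) (rule conjunct1)
    show "\<exists>e. \<forall>t\<in>Poly_Mapping.keys p. weight (omega n) t = e" if "p \<in> ?S" for p
      using *[OF that] by (rule conjunct2)
  qed
qed

end
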